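(* There do not exist sum-of-squares polynomials $q_0,q_1,q_2,q_3,q_4\in\mathbb{R}[x,y]$ such that $$xy\equiv q_0+q_1x+q_2y+q_3(1-x)+q_4(1-y).$$ In other words, the polynomial $xy$ does not have a Putinar representation over the unit box $[0,1]\times[0,1]$.
   Context: A polynomial $q\in\mathbb{R}[x,y]$ is a sum-of-squares (SOS) polynomial if $q\equiv g_1^2+\dots+g_k^2$ for some real polynomials $g_1,\dots,g_k$. A Putinar representation of $p$ over $K=\{p_1\ge0,\dots,p_m\ge0\}$ is an identity $p\equiv q_0+q_1p_1+\dots+q_mp_m$ with all $q_j$ SOS; here the unit box is defined by $x\ge0$, $y\ge0$, $1-x\ge0$, $1-y\ge0$. *)

theory Defs
  imports "HOL-Computational_Algebra.Polynomial"
begin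

text \<open>
  The ring of real polynomials in \<open>x\<close> and \<open>y\<close> is represented by \<^typ>\<open>real poly poly\<close>, that is
  \<open>(\<real>[x])[y]\<close>: the coefficients of the outer polynomial are polynomials in \<open>x\<close>.
\<close>

definition X :: "real poly poly" where
  "X = [:[:0, 1:]:]"

definition Y :: "real poly poly" where
  "Y = [:0, 1:]"

definition sos :: "real poly poly \<Rightarrow> bool" where
  "sos q \<longleftrightarrow> (\<exists>(k::nat) (g :: nat \<Rightarrow> real poly poly). q = (\<Sum>i=1..k. (g i)\<^sup>2))"

text \<open>
  The list \<open>ps = [p\<^sub>1, \<dots>, p\<^sub>m]\<close> is the description \<open>p\<^sub>1 \<ge> 0, \<dots>, p\<^sub>m \<ge> 0\<close> of \<open>K\<close>. Having a
  Putinar representation depends on this description and not only on \<open>K\<close> as a set. List indices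
  start at 0, so \<open>ps ! i\<close> is \<open>p\<^sub>i\<^sub>+\<^sub>1\<close>, and its multiplier is \<open>q (i + 1)\<close>.
\<close>

definition has_putinar_representation :: "real poly poly \<Rightarrow> real poly poly list \<Rightarrow> bool" where
  "has_putinar_representation p ps \<longleftrightarrow>
     (\<exists>q :: nat \<Rightarrow> real poly poly.
        (\<forall>j\<le>length ps. sos (q j)) \<and>
        p = q 0 + (\<Sum>i<length ps. q (i + 1) * ps ! i))"

definition unit_box :: "real poly poly list" where
  "unit_box = [X, Y, 1 - X, 1 - Y]"

end

theory Submission imports Defs begin

text \<open>
  The obstruction sits at the corner \<open>(0, 0)\<close> of the box, and it becomes visible on the two
  lines through it of slope \<open>1\<close> and \<open>-1\<close>. Suppose that
  \<open>x y = q\<^sub>0 + q\<^sub>1 x + q\<^sub>2 y + q\<^sub>3 (1 - x) + q\<^sub>4 (1 - y)\<close> with all \<open>q\<^sub>j\<close> sums of squares.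

  On the diagonal \<open>(t, t)\<close> with \<open>0 < t < 1\<close> every summand is nonnegative, so that
  \<open>t (q\<^sub>1 + q\<^sub>2) \<le> t\<^sup>2\<close>. Dividing by \<open>t\<close> and letting \<open>t\<close> tend to \<open>0\<close> shows that \<open>q\<^sub>1\<close> and
  \<open>q\<^sub>2\<close> vanish at the corner. But a sum of squares that vanishes at a point vanishes there to
  second order (\<open>sos_zero_double\<close>).

  On the antidiagonal \<open>(t, -t)\<close>, which leaves the box, \<open>x y\<close> takes the negative value
  \<open>- t\<^sup>2\<close>. For \<open>0 < t < 1\<close> the weights \<open>1 - t\<close> and \<open>1 + t\<close> of \<open>q\<^sub>3\<close> and \<open>q\<^sub>4\<close> are still
  positive, so only the terms \<open>t q\<^sub>1 - t q\<^sub>2\<close> can be negative. These are of order \<open>t\<^sup>3\<close>, too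
  small to produce \<open>- t\<^sup>2\<close>.
\<close>

text \<open>
  Since the outer variable is \<open>y\<close>, the polynomial \<open>poly q u\<close> is the restriction of \<open>q\<close> to the
  graph \<open>y = u(x)\<close>. Its value at \<open>a\<close> depends only on the point \<open>(a, u(a))\<close>, which allows values
  to be compared where two graphs cross.
\<close>

lemma poly_poly_at_point:
  fixes q :: "'a::comm_semiring_1 poly poly"
  shows "poly (poly q u) a = poly (poly q [:poly u a:]) a"
  by (induction q) auto

lemma sos_restrict:
  assumes "sos q"
  obtains k :: nat and g :: "nat \<Rightarrow> real poly" where "poly q u = (\<Sum>i=1..k. (g i)\<^sup>2)"
proof -
  obtain k :: nat and g where q: "q = (\<Sum>i=1..k. (g i)\<^sup>2)"
    using assms unfolding sos_def by blast
  have "poly q u = (\<Sum>i=1..k. (poly (g i) u)\<^sup>2)"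
    by (simp add: q poly_sum)
  then show thesis by (rule that)
qed

lemma sos_nonneg:
  assumes "sos q"
  shows "poly (poly q u) t \<ge> 0"
proof -
  obtain k :: nat and g where "poly q u = (\<Sum>i=1..k. (g i)\<^sup>2)"
    using assms by (rule sos_restrict)
  then show ?thesis by (simp add: poly_sum sum_nonneg)
qed

text \<open>
  If a sum of real squares is zero, each square is zero. So every \<open>g\<^sub>i\<close> has the root \<open>a\<close>, and
  every \<open>g\<^sub>i\<^sup>2\<close> has it twice.
\<close>

lemma sos_zero_double:
  assumes "sos q" and zero: "poly (poly q u) a = 0"
  shows "[:-a, 1:]\<^sup>2 dvd poly q u"
proof -
  obtain k :: nat and g where g: "poly q u = (\<Sum>i=1..k. (g i)\<^sup>2)"
    using assms(1) by (rule sos_restrict)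
  from zero have "(\<Sum>i=1..k. (poly (g i) a)\<^sup>2) = 0"
    by (simp add: g poly_sum)
  then have "poly (g i) a = 0" if "i \<in> {1..k}" for i
    using that by (simp add: sum_nonneg_eq_0_iff)
  then have "[:-a, 1:]\<^sup>2 dvd (g i)\<^sup>2" if "i \<in> {1..k}" for i
    using that by (simp add: dvd_power_same poly_eq_0_iff_dvd)
  then show ?thesis
    unfolding g by (rule dvd_sum)
qed

lemma poly_nonpos_at_left_end:
  fixes p :: "real poly"
  assumes "\<And>t. 0 < t \<Longrightarrow> t < 1 \<Longrightarrow> poly p t \<le> 0"
  shows "poly p 0 \<le> 0"
proof (rule tendsto_upperbound)
  show "(poly p \<longlongrightarrow> poly p 0) (at_right 0)"
    by (intro tendsto_intros)
  show "eventually (\<lambda>t. poly p t \<le> 0) (at_right 0)"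
    using assms by (auto simp: eventually_at_right[of 0 1] intro!: exI[of _ 1])
qed simp

lemma xy_no_box_identity:
  assumes sos: "sos q0" "sos q1" "sos q2" "sos q3" "sos q4"
    and eq: "X * Y = q0 + q1 * X + q2 * Y + q3 * (1 - X) + q4 * (1 - Y)"
  shows False
proof -
  define R :: "real \<Rightarrow> real poly poly \<Rightarrow> real poly" where "R s q = poly q [:0, s:]" for s q
  have nonneg: "0 \<le> poly (R s q) t" if "sos q" for s q t
    using that unfolding R_def by (rule sos_nonneg)
  have corner: "poly (R s q) 0 = poly (poly q 0) 0" for s q
    unfolding R_def by (subst poly_poly_at_point) simp
  have line: "s * t\<^sup>2 = poly (R s q0) t + t * poly (R s q1) t + s * t * poly (R s q2) t
      + (1 - t) * poly (R s q3) t + (1 - s * t) * poly (R s q4) t" for s t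
  proof -
    have "poly (R s (X * Y)) t
        = poly (R s (q0 + q1 * X + q2 * Y + q3 * (1 - X) + q4 * (1 - Y))) t"
      using eq by simp
    then show ?thesis
      by (simp add: R_def X_def Y_def power2_eq_square algebra_simps)
  qed
  have drop: "t * (poly (R s q1) t + s * poly (R s q2) t) \<le> s * t\<^sup>2"
    if "t \<le> 1" "s * t \<le> 1" for s t
  proof -
    have "0 \<le> (1 - t) * poly (R s q3) t" "0 \<le> (1 - s * t) * poly (R s q4) t"
      using that sos by (simp_all add: nonneg)
    with nonneg[OF sos(1), of s t] line[of s t] show ?thesis
      by (simp add: algebra_simps)
  qed

  \<comment> \<open>The bound on the diagonal, divided by \<open>t\<close>, reads \<open>q\<^sub>1 + q\<^sub>2 \<le> t\<close>.\<close>
  have "poly (R 1 q1 + R 1 q2 - [:0, 1:]) 0 \<le> 0"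
  proof (rule poly_nonpos_at_left_end)
    fix t :: real assume "0 < t" "t < 1"
    then have "t * (poly (R 1 q1) t + poly (R 1 q2) t) \<le> t * t"
      using drop[of t 1] by (simp add: power2_eq_square)
    with \<open>0 < t\<close> show "poly (R 1 q1 + R 1 q2 - [:0, 1:]) t \<le> 0"
      by simp
  qed
  then have "poly (poly q1 0) 0 = 0" "poly (poly q2 0) 0 = 0"
    using nonneg[OF sos(2), of 1 0] nonneg[OF sos(3), of 1 0] by (simp_all add: corner)
  then have "[:-0, 1:]\<^sup>2 dvd R (-1) q1" "[:-0, 1:]\<^sup>2 dvd R (-1) q2"
    using sos_zero_double[OF sos(2), of "[:0, -1:]" 0] sos_zero_double[OF sos(3), of "[:0, -1:]" 0]
      corner[of "-1"] by (simp_all add: R_def)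
  then have "[:-0, 1:]\<^sup>2 dvd R (-1) q1 - R (-1) q2"
    by (rule dvd_diff)
  then obtain h where h: "R (-1) q1 - R (-1) q2 = [:-0, 1:]\<^sup>2 * h" ..

  \<comment> \<open>The bound on the antidiagonal, divided by \<open>t\<^sup>2\<close>, reads \<open>t h(t) \<le> -1\<close>; this fails at \<open>0\<close>.\<close>
  have "poly ([:0, 1:] * h + 1) 0 \<le> 0"
  proof (rule poly_nonpos_at_left_end)
    fix t :: real assume t: "0 < t" "t < 1"
    have "poly (R (-1) q1) t - poly (R (-1) q2) t = t\<^sup>2 * poly h t"
      using arg_cong[OF h, of "\<lambda>p. poly p t"] by simp
    then have "t\<^sup>2 * (t * poly h t + 1) \<le> 0"
      using drop[of t "-1"] t by (simp add: algebra_simps)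
    with t show "poly ([:0, 1:] * h + 1) t \<le> 0"
      by (simp add: mult_le_0_iff)
  qed
  then show False by simp
qed

theorem proposition4p2:
  "(\<nexists>q0 q1 q2 q3 q4 :: real poly poly.
      sos q0 \<and> sos q1 \<and> sos q2 \<and> sos q3 \<and> sos q4 \<and>
      X * Y = q0 + q1 * X + q2 * Y + q3 * (1 - X) + q4 * (1 - Y))
   \<and> \<not> has_putinar_representation (X * Y) unit_box"
proof (intro conjI notI)
  assume "\<exists>q0 q1 q2 q3 q4. sos q0 \<and> sos q1 \<and> sos q2 \<and> sos q3 \<and> sos q4 \<and>
      X * Y = q0 + q1 * X + q2 * Y + q3 * (1 - X) + q4 * (1 - Y)"
  then show False using xy_no_box_identity by blast
next
  assume "has_putinar_representation (X * Y) unit_box"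
  then obtain q where q: "\<And>j. j \<le> length unit_box \<Longrightarrow> sos (q j)"
    and eq: "X * Y = q 0 + (\<Sum>i<length unit_box. q (i + 1) * unit_box ! i)"
    unfolding has_putinar_representation_def by blast
  have "X * Y = q 0 + q 1 * X + q 2 * Y + q 3 * (1 - X) + q 4 * (1 - Y)"
    using eq by (simp add: unit_box_def eval_nat_numeral add.assoc)
  with q show False
    using xy_no_box_identity[of "q 0" "q 1" "q 2" "q 3" "q 4"] by (simp add: unit_box_def)
qed

end
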